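(* Every planar graph $G$ admits a maximum matching $M$ such that either $M$ is perfect, or every vertex unmatched by $M$ has degree at most $5$ in $G$.
   Context: Graphs are finite and simple. A vertex is unmatched by $M$ if it is incident to no edge of $M$; a matching is perfect if there is no unmatched vertex. A maximum matching is one of maximum cardinality. *)

theory Defs
  imports "HOL-Analysis.Analysis"
begin

text \<open>A graph is given by its vertex set and its set of edges, each edge being the
  two-element set of its ends; this excludes loops and multiple edges.\<close>

definition finite_simple_graph :: "'a set \<Rightarrow> 'a set set \<Rightarrow> bool" where
  "finite_simple_graph V E \<longleftrightarrow> finite V \<and> (\<forall>e\<in>E. e \<subseteq> V \<and> card e = 2)"

definition vertex_degree :: "'a set set \<Rightarrow> 'a \<Rightarrow> nat" where
  "vertex_degree E v = card {e \<in> E. v \<in> e}"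

definition matching :: "'a set set \<Rightarrow> 'a set set \<Rightarrow> bool" where
  "matching E M \<longleftrightarrow> M \<subseteq> E \<and> pairwise disjnt M"

definition maximum_matching :: "'a set set \<Rightarrow> 'a set set \<Rightarrow> bool" where
  "maximum_matching E M \<longleftrightarrow> matching E M \<and> (\<forall>M'. matching E M' \<longrightarrow> card M' \<le> card M)"

definition unmatched :: "'a set \<Rightarrow> 'a set set \<Rightarrow> 'a set" where
  "unmatched V M = {v \<in> V. \<forall>e\<in>M. v \<notin> e}"

definition perfect :: "'a set \<Rightarrow> 'a set set \<Rightarrow> bool" where
  "perfect V M \<longleftrightarrow> unmatched V M = {}"

text \<open>A drawing without crossings in the Euclidean plane, which is taken to be \<^typ>\<open>complex\<close>:
  \<open>p\<close> places the vertices and \<open>c e\<close> is a simple arc joining the two ends of \<open>e\<close>. An arc passes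
  through no vertex other than its own ends, and distinct arcs meet only in a common end.\<close>

definition plane_drawing ::
    "'a set \<Rightarrow> 'a set set \<Rightarrow> ('a \<Rightarrow> complex) \<Rightarrow> ('a set \<Rightarrow> real \<Rightarrow> complex) \<Rightarrow> bool" where
  "plane_drawing V E p c \<longleftrightarrow>
     inj_on p V \<and>
     (\<forall>e\<in>E. arc (c e) \<and> {pathstart (c e), pathfinish (c e)} = p ` e) \<and>
     (\<forall>e\<in>E. path_image (c e) \<inter> p ` V = p ` e) \<and>
     (\<forall>e\<in>E. \<forall>f\<in>E. e \<noteq> f \<longrightarrow> path_image (c e) \<inter> path_image (c f) \<subseteq> p ` (e \<inter> f))"

definition planar :: "'a set \<Rightarrow> 'a set set \<Rightarrow> bool" where
  "planar V E \<longleftrightarrow> (\<exists>p c. plane_drawing V E p c)"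

end

theory Submission
  imports Defs
begin

text \<open>Choose a maximum matching \<open>M\<close> with as few unmatched vertices of degree at least 6 as
  possible, and suppose that \<open>u\<close> is one. Delete the other unmatched vertices; in what remains let
  \<open>D\<close> be the set of vertices missed by some maximum matching and \<open>A\<close> the set of their neighbours
  outside \<open>D\<close>. Each vertex of \<open>D\<close> could replace \<open>u\<close> as an unmatched vertex, so by minimality it
  has degree at least 6, and all its neighbours lie in \<open>D \<union> A\<close>. By the Gallai--Edmonds argument
  the number \<open>k\<close> of components of the graph induced on \<open>D\<close> is at least \<open>card A\<close>.

  Euler's formula gives at most \<open>3(n - k)\<close> edges in a planar graph with \<open>n\<close> vertices and \<open>k\<close>
  components. With \<open>i\<close> edges inside \<open>D\<close> and \<open>b\<close> edges between \<open>D\<close> and \<open>A\<close> this bounds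
  \<open>6 card D \<le> 2 i + b\<close> by \<open>3 (card D - k) + 3 (card D + card A - 1) < 6 card D\<close>, a contradiction.

  For the edge bound, bridges are removed one at a time. If there is no bridge, every edge \<open>e\<close> lies
  on a Jordan curve \<open>J\<close> formed by edges, both sides of which accumulate at \<open>e\<close>; so removing \<open>e\<close>
  decreases the number of faces, and Janiszewski's theorem shows that \<open>e\<close> borders at most one
  face on each side of \<open>J\<close>.\<close>

section \<open>Arcs and faces in the plane\<close>

text \<open>Otherwise the homeomorphism from the arc to an interval, read as a complex-valued map on
  the interior, would by invariance of domain have a nonempty open image inside the real
  axis.\<close>

lemma interior_arc_image_complex:
  fixes c :: "real \<Rightarrow> complex"
  assumes "arc c"
  shows "interior (path_image c) = {}"
proof -
  obtain f g where fg: "homeomorphism (path_image c) {0..1::real} f g"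
    using homeomorphic_arc_image_interval[OF assms, of 0 1] unfolding homeomorphic_def by auto
  let ?U = "interior (path_image c)" and ?h = "\<lambda>x. complex_of_real (f x)"
  have "open (?h ` ?U)"
  proof (rule invariance_of_domain)
    have "continuous_on (path_image c) f" using fg by (simp add: homeomorphism_def)
    then show "continuous_on ?U ?h"
      by (intro continuous_intros) (meson continuous_on_subset interior_subset)
    show "inj_on ?h ?U"
      using fg interior_subset unfolding inj_on_def homeomorphism_def
      by (metis of_real_eq_iff subsetD)
  qed simp
  moreover have "?h ` ?U \<subseteq> {z. Im z = 0}" by auto
  moreover have "interior {z::complex. Im z = 0} = {}"
    using interior_hyperplane[of \<i> 0] by (simp add: inner_complex_def)
  ultimately have "?h ` ?U = {}"
    by (metis interior_maximal subset_empty)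
  then show ?thesis by blast
qed

text \<open>Neither arc separates the plane, and their intersection, being empty or a point, is
  connected; so Janiszewski's theorem applies. The finite set \<open>T\<close> is then removed from
  a connected open set.\<close>

lemma connected_complement_two_arcs:
  fixes c d :: "real \<Rightarrow> complex"
  assumes "arc c" "arc d" "path_image c \<inter> path_image d \<subseteq> {a}" "finite T"
  shows "connected (- (path_image c \<union> path_image d \<union> T))"
proof -
  have "connected (path_image c \<inter> path_image d)"
    using assms(3) by (metis connected_empty connected_sing subset_singletonD)
  then have "connected (- (path_image c \<union> path_image d))"
    using assms by (intro Janiszewski_connected)
      (auto simp: compact_arc_image closed_arc_image connected_arc_complement)
  moreover have "open (- (path_image c \<union> path_image d))"
    using assms by (intro open_Compl closed_Un closed_arc_image)
  ultimately have "connected (- (path_image c \<union> path_image d) - T)"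
    using assms(4) by (intro connected_open_delete_finite) auto
  then show ?thesis by (simp add: Diff_eq)
qed

lemma infinite_arc_image:
  assumes "arc c"
  shows "infinite (path_image c)"
proof -
  have "infinite {0..1::real}" by (rule infinite_Icc) simp
  then show ?thesis
    using assms unfolding arc_def path_image_def by (metis finite_imageD)
qed

section \<open>Faces and the effect of adding an arc\<close>

definition faces :: "complex set \<Rightarrow> complex set set" where
  "faces S = components (- S)"

lemma face_disjnt: "f \<in> faces S \<Longrightarrow> f \<inter> S = {}"
  unfolding faces_def using in_components_subset by fastforce

lemma face_open: "f \<in> faces S \<Longrightarrow> compact S \<Longrightarrow> open f"
  unfolding faces_def by (metis compact_imp_closed open_Compl open_components)

lemma face_connected: "f \<in> faces S \<Longrightarrow> connected f"
  unfolding faces_def by (rule in_components_connected)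

lemma face_nonempty: "f \<in> faces S \<Longrightarrow> f \<noteq> {}"
  unfolding faces_def by (rule in_components_nonempty)

lemma face_maximal:
  "f \<in> faces S \<Longrightarrow> connected X \<Longrightarrow> X \<inter> S = {} \<Longrightarrow> f \<inter> X \<noteq> {} \<Longrightarrow> X \<subseteq> f"
  unfolding faces_def by (metis components_maximal disjoint_eq_subset_Compl)

lemma face_eqI: "f \<in> faces S \<Longrightarrow> g \<in> faces S \<Longrightarrow> connected_component (- S) a b \<Longrightarrow> a \<in> f \<Longrightarrow> b \<in> g \<Longrightarrow> f = g"
  unfolding faces_def
  by (metis joinable_components_eq connected_component_def disjoint_iff)

lemma faceE: assumes "x \<notin> S" obtains f where "f \<in> faces S" "x \<in> f"
  unfolding faces_def using assms by (metis Compl_iff UnionE Union_components)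

text \<open>An arc has empty interior, so it cannot fill the open face \<open>f\<close>; a point
  left over lies in a face of the larger set.\<close>

lemma face_subface:
  assumes "arc c" "compact S" "f \<in> faces S"
  obtains g where "g \<in> faces (S \<union> path_image c)" "g \<subseteq> f"
proof -
  have "\<not> f \<subseteq> path_image c"
    using interior_arc_image_complex[OF assms(1)] face_open[OF assms(3,2)] face_nonempty[OF assms(3)]
    by (metis interior_maximal subset_empty)
  then obtain x where x: "x \<in> f" "x \<notin> path_image c" by auto
  then have "x \<notin> S \<union> path_image c" using face_disjnt[OF assms(3)] by auto
  then obtain g where g: "g \<in> faces (S \<union> path_image c)" "x \<in> g" by (rule faceE)
  have "g \<subseteq> f"
    using face_maximal[OF assms(3) face_connected[OF g(1)]] face_disjnt[OF g(1)] x g by auto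
  with g show thesis using that by blast
qed

lemma face_superface:
  assumes "g \<in> faces (S \<union> T)"
  obtains f where "f \<in> faces S" "g \<subseteq> f"
proof -
  obtain x where x: "x \<in> g" using face_nonempty[OF assms] by auto
  then have "x \<notin> S" using face_disjnt[OF assms] by auto
  then obtain f where f: "f \<in> faces S" "x \<in> f" by (rule faceE)
  have "g \<subseteq> f"
    using face_maximal[OF f(1) face_connected[OF assms]] face_disjnt[OF assms] x f by auto
  with f show thesis using that by blast
qed

lemma faces_disjoint: "f \<in> faces S \<Longrightarrow> g \<in> faces S \<Longrightarrow> f \<inter> g \<noteq> {} \<Longrightarrow> f = g"
  unfolding faces_def using components_nonoverlap by metis

text \<open>Every new face lies in exactly one old face and every old face contains a new one, so
  \<open>F\<close> is a surjection. Comparing numbers of faces becomes a question of its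
  injectivity.\<close>

lemma faces_add_arc_image:
  assumes "arc c" "compact S"
  defines "F \<equiv> \<lambda>g. THE f. f \<in> faces S \<and> g \<subseteq> f"
  shows "F ` faces (S \<union> path_image c) = faces S"
    and "\<And>f g. f \<in> faces S \<Longrightarrow> g \<in> faces (S \<union> path_image c) \<Longrightarrow> g \<subseteq> f \<Longrightarrow> F g = f"
proof -
  show F: "F g = f" if "f \<in> faces S" "g \<in> faces (S \<union> path_image c)" "g \<subseteq> f" for f g
    unfolding F_def
    using that face_nonempty[OF that(2)] faces_disjoint[of _ S f] by (intro the_equality) auto
  show "F ` faces (S \<union> path_image c) = faces S"
  proof
    show "F ` faces (S \<union> path_image c) \<subseteq> faces S"
    proof
      fix f assume "f \<in> F ` faces (S \<union> path_image c)"
      then obtain g where g: "g \<in> faces (S \<union> path_image c)" "f = F g" by auto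
      obtain h where "h \<in> faces S" "g \<subseteq> h" using face_superface[OF g(1)] .
      then show "f \<in> faces S" using F g by metis
    qed
    show "faces S \<subseteq> F ` faces (S \<union> path_image c)"
    proof
      fix f assume f: "f \<in> faces S"
      obtain g where "g \<in> faces (S \<union> path_image c)" "g \<subseteq> f" using face_subface[OF assms(1,2) f] .
      then show "f \<in> F ` faces (S \<union> path_image c)" using F f by (metis imageI)
    qed
  qed
qed

lemma card_faces_add_arc:
  assumes "arc c" "compact S" "finite (faces (S \<union> path_image c))"
  shows "finite (faces S)" "card (faces S) \<le> card (faces (S \<union> path_image c))"
  using faces_add_arc_image(1)[OF assms(1,2)] assms(3) by (metis finite_imageI, metis card_image_le)

text \<open>The model of an edge that is not a bridge: \<open>c\<close> is its arc, \<open>S\<close>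
  the rest of the drawing, and \<open>q\<close> an arc within \<open>S\<close> leading back, so that
  \<open>c\<close> and \<open>q\<close> form a Jordan curve.\<close>

locale chord =
  fixes S :: "complex set" and c q :: "real \<Rightarrow> complex"
  assumes compact: "compact S" and arcs: "arc c" "arc q"
    and q: "path_image q \<subseteq> S" "pathstart q = pathfinish c" "pathfinish q = pathstart c"
    and meet: "path_image c \<inter> S \<subseteq> {pathstart c, pathfinish c}"
begin

definition J :: "complex set" where "J = path_image c \<union> path_image q"

lemma simple_J: "simple_path (c +++ q)"
  using arcs q meet by (intro simple_path_join_loop) auto

lemma J_eq: "path_image (c +++ q) = J"
  using q by (simp add: path_image_join J_def)

lemma J_loop: "pathfinish (c +++ q) = pathstart (c +++ q)"
  using q by simp

lemmas J_jordan = Jordan_inside_outside[OF simple_J J_loop, unfolded J_eq]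

lemma ends: "{pathstart c, pathfinish c} \<subseteq> path_image q" "{pathstart c, pathfinish c} \<subseteq> S"
  using q pathfinish_in_path_image[of q] pathstart_in_path_image[of q] by auto

lemma meet_J: "S \<inter> J = path_image q"
  using q meet ends by (auto simp: J_def)

lemma union_J: "S \<union> J = S \<union> path_image c"
  using q by (auto simp: J_def)

text \<open>Janiszewski's theorem applies to \<open>S\<close> and the Jordan curve \<open>J\<close> because they meet in the
  connected set \<open>path_image q\<close>.\<close>

lemma same_side_connected:
  assumes "connected_component (- S) a b"
    and "{a,b} \<subseteq> inside J \<or> {a,b} \<subseteq> outside J"
  shows "connected_component (- (S \<union> path_image c)) a b"
proof -
  have "connected_component (- J) a b"
  proof -
    have "inside J \<subseteq> - J" "outside J \<subseteq> - J" using J_jordan by blast+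
    then show ?thesis
      using assms(2) J_jordan unfolding connected_component_def by (meson insert_subset)
  qed
  moreover have "connected (S \<inter> J)" using meet_J arcs connected_arc_image by metis
  moreover have "closed J" unfolding J_def using arcs by (simp add: closed_arc_image closed_Un)
  ultimately show ?thesis using Janiszewski[OF compact] assms(1) union_J by metis
qed

text \<open>The face of \<open>S\<close> around a point of \<open>c\<close> outside \<open>S\<close>
  meets both sides of \<open>J\<close>, whereas a new face is connected and avoids \<open>J\<close>.
  So two new faces lie in one old face, and the surjection between faces is not injective.\<close>

lemma card_faces_less:
  assumes "finite (faces (S \<union> path_image c))"
  shows "card (faces S) < card (faces (S \<union> path_image c))"
proof -
  have "\<not> path_image c \<subseteq> {pathstart c, pathfinish c}"
    using infinite_arc_image[OF arcs(1)] finite_subset[of _ "{pathstart c, pathfinish c}"] by auto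
  then obtain x where x: "x \<in> path_image c" "x \<notin> S" using meet by blast
  obtain f where f: "f \<in> faces S" "x \<in> f" using faceE[OF x(2)] .
  have of: "open f" using face_open[OF f(1) compact] .
  have xJ: "x \<in> J" using x J_def by auto
  \<comment> \<open>Both sides of a Jordan curve have the whole curve as frontier.\<close>
  have "x \<in> closure (inside J)" "x \<in> closure (outside J)"
    using J_jordan xJ by (auto simp: frontier_def)
  then have "f \<inter> inside J \<noteq> {}" "f \<inter> outside J \<noteq> {}"
    using f(2) open_Int_closure_eq_empty[OF of] by blast+
  then obtain a b where ab: "a \<in> f" "a \<in> inside J" "b \<in> f" "b \<in> outside J" by auto
  have io: "inside J \<inter> outside J = {}" "inside J \<union> outside J = - J" using J_jordan by auto
  then have "a \<notin> S \<union> path_image c" "b \<notin> S \<union> path_image c"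
    using ab face_disjnt[OF f(1)] union_J by blast+
  then obtain g h where gh: "g \<in> faces (S \<union> path_image c)" "a \<in> g"
     "h \<in> faces (S \<union> path_image c)" "b \<in> h" by (metis faceE)
  have sub: "g \<subseteq> f" "h \<subseteq> f"
    using face_maximal[OF f(1) face_connected] face_disjnt gh ab by blast+
  have "g \<noteq> h"
  proof
    assume "g = h"
    then have "g \<inter> inside J \<noteq> {}" "g \<inter> outside J \<noteq> {}" using gh ab by auto
    moreover have "g \<subseteq> inside J \<union> outside J" using io face_disjnt[OF gh(1)] union_J by auto
    moreover have "open (inside J)" "open (outside J)" using J_jordan by auto
    ultimately show False using connectedD[OF face_connected[OF gh(1)], of "inside J" "outside J"] io
      by auto
  qed
  let ?F = "\<lambda>g. THE f. f \<in> faces S \<and> g \<subseteq> f"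
  note F = faces_add_arc_image[OF arcs(1) compact]
  have "?F g = ?F h" using F(2)[OF f(1) gh(1) sub(1)] F(2)[OF f(1) gh(3) sub(2)] by (rule trans[OF _ sym])
  with \<open>g \<noteq> h\<close> have "\<not> inj_on ?F (faces (S \<union> path_image c))"
    using inj_onD[OF _ _ gh(1,3)] by blast
  then have "card (?F ` faces (S \<union> path_image c)) < card (faces (S \<union> path_image c))"
    using card_image_le[OF assms, of ?F] eq_card_imp_inj_on[OF assms, of ?F] by linarith
  then show ?thesis unfolding F(1) .
qed

text \<open>All these faces lie in the one face of \<open>S\<close> that contains the chord without
  its ends, and each lies on one side of \<open>J\<close>; two on the same side coincide by
  \<open>same_side_connected\<close>.\<close>

lemma card_incident_faces:
  "finite {f \<in> faces (S \<union> path_image c). frontier f \<inter> (path_image c - S) \<noteq> {}}"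
  "card {f \<in> faces (S \<union> path_image c). frontier f \<inter> (path_image c - S) \<noteq> {}} \<le> 2"
proof -
  let ?I = "{f \<in> faces (S \<union> path_image c). frontier f \<inter> (path_image c - S) \<noteq> {}}"
  have "\<not> path_image c \<subseteq> {pathstart c, pathfinish c}"
    using infinite_arc_image[OF arcs(1)] finite_subset[of _ "{pathstart c, pathfinish c}"] by auto
  then obtain x where x: "x \<in> path_image c" "x \<notin> S" using meet by blast
  obtain g where g: "g \<in> faces S" "x \<in> g" using faceE[OF x(2)] .
  have cg: "path_image c - S \<subseteq> g"
  proof -
    have "connected (path_image c - {pathstart c, pathfinish c})"
      using connected_simple_path_endless arcs(1) arc_imp_simple_path by blast
    moreover have "x \<in> path_image c - {pathstart c, pathfinish c}"
      using x ends by auto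
    ultimately have "path_image c - {pathstart c, pathfinish c} \<subseteq> g"
      using meet g by (intro face_maximal[OF g(1)]) auto
    moreover have "path_image c - S \<subseteq> path_image c - {pathstart c, pathfinish c}"
      using ends by blast
    ultimately show ?thesis by blast
  qed
  have io: "inside J \<inter> outside J = {}" "inside J \<union> outside J = - J" using J_jordan by auto
  have fg: "f \<subseteq> g" "f \<subseteq> inside J \<or> f \<subseteq> outside J" if f: "f \<in> ?I" for f
  proof -
    obtain y where y: "y \<in> frontier f" "y \<in> g" using f cg by auto
    then have "f \<inter> g \<noteq> {}"
      using face_open[OF g(1) compact] open_Int_closure_eq_empty[of g f] by (auto simp: frontier_def)
    then show "f \<subseteq> g"
      using f face_disjnt[of f] face_connected[of f] by (intro face_maximal[OF g(1)]) auto
    have "f \<subseteq> inside J \<union> outside J" using io face_disjnt[of f] f union_J by auto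
    moreover have "open (inside J)" "open (outside J)" using J_jordan by auto
    ultimately show "f \<subseteq> inside J \<or> f \<subseteq> outside J"
      using connectedD[OF face_connected[of f], of _ "inside J" "outside J"] io f by blast
  qed
  \<comment> \<open>An injection into \<open>bool\<close> yields finiteness as well as the bound
    2.\<close>
  have inj: "inj_on (\<lambda>f. f \<subseteq> inside J) ?I"
  proof (rule inj_onI)
    fix f h assume f: "f \<in> ?I" and h: "h \<in> ?I" and eq: "(f \<subseteq> inside J) = (h \<subseteq> inside J)"
    obtain a b where ab: "a \<in> f" "b \<in> h" using f h face_nonempty by blast
    have "connected_component (- S) a b"
      using ab fg f h face_connected[OF g(1)] face_disjnt[OF g(1)]
      unfolding connected_component_def by (intro exI[of _ g]) auto
    moreover have "{a,b} \<subseteq> inside J \<or> {a,b} \<subseteq> outside J"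
      using fg f h eq ab by blast
    ultimately show "f = h" using same_side_connected face_eqI f h ab by blast
  qed
  show "finite ?I" using inj finite_imageD finite by blast
  have "card ?I \<le> card (UNIV :: bool set)" using inj by (intro card_inj_on_le) auto
  then show "card ?I \<le> 2" by simp
qed

end

section \<open>Connected components\<close>

definition edge_rel :: "'a set set \<Rightarrow> ('a \<times> 'a) set" where
  "edge_rel E = {(a, b). {a, b} \<in> E}"

text \<open>The closure is reflexive, so an isolated vertex is a component of its own and is counted
  by \<open>ncomp\<close>.\<close>

definition comp_of :: "'a set set \<Rightarrow> 'a \<Rightarrow> 'a set" where
  "comp_of E v = (edge_rel E)\<^sup>* `` {v}"

definition ncomp :: "'a set \<Rightarrow> 'a set set \<Rightarrow> nat" where
  "ncomp V E = card (comp_of E ` V)"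

lemma edge_rel_rtrancl_sym: "(a, b) \<in> (edge_rel E)\<^sup>* \<Longrightarrow> (b, a) \<in> (edge_rel E)\<^sup>*"
proof -
  have "sym (edge_rel E)" by (auto simp: sym_def edge_rel_def insert_commute)
  then show "(a, b) \<in> (edge_rel E)\<^sup>* \<Longrightarrow> (b, a) \<in> (edge_rel E)\<^sup>*"
    by (meson sym_rtrancl symD)
qed

lemma comp_of_eq_iff: "comp_of E a = comp_of E b \<longleftrightarrow> (a, b) \<in> (edge_rel E)\<^sup>*"
  unfolding comp_of_def by (auto intro: rtrancl_trans dest: edge_rel_rtrancl_sym)

lemma edge_rel_mono: "E \<subseteq> E' \<Longrightarrow> (edge_rel E)\<^sup>* \<subseteq> (edge_rel E')\<^sup>*"
  by (intro rtrancl_mono) (auto simp: edge_rel_def)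

text \<open>Closing up under the larger relation maps old components onto new ones; both
  monotonicity and the strict drop at a bridge are read off this map.\<close>

lemma comp_of_mono_image:
  assumes "E \<subseteq> E'"
  shows "(\<lambda>X. (edge_rel E')\<^sup>* `` X) ` comp_of E ` V = comp_of E' ` V"
proof -
  have "(edge_rel E')\<^sup>* `` comp_of E v = comp_of E' v" for v
    using edge_rel_mono[OF assms] unfolding comp_of_def by (auto intro: rtrancl_trans)
  then show ?thesis by (simp add: image_image)
qed

lemma ncomp_antimono:
  assumes "finite V" "E \<subseteq> E'"
  shows "ncomp V E' \<le> ncomp V E"
  unfolding ncomp_def using comp_of_mono_image[OF assms(2), of V] assms(1)
  by (metis card_image_le finite_imageI)

text \<open>The map from old to new components identifies the distinct components of
  \<open>u\<close> and \<open>v\<close>.\<close>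

lemma ncomp_insert_bridge:
  assumes "finite V" "u \<in> V" "v \<in> V" "(u, v) \<notin> (edge_rel E)\<^sup>*"
  shows "ncomp V (insert {u, v} E) < ncomp V E"
proof -
  let ?E = "insert {u, v} E" and ?f = "\<lambda>X. (edge_rel (insert {u, v} E))\<^sup>* `` X"
  have img: "?f ` comp_of E ` V = comp_of ?E ` V" by (rule comp_of_mono_image) auto
  have "(u, v) \<in> (edge_rel ?E)\<^sup>*" by (auto simp: edge_rel_def)
  then have "comp_of ?E u = comp_of ?E v" by (simp add: comp_of_eq_iff)
  moreover have "?f (comp_of E w) = comp_of ?E w" for w
    using comp_of_mono_image[of E ?E "{w}"] by auto
  moreover have "comp_of E u \<noteq> comp_of E v" using assms by (simp add: comp_of_eq_iff)
  ultimately have "\<not> inj_on ?f (comp_of E ` V)"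
    using assms(2,3) by (metis imageI inj_onD)
  then have "card (?f ` comp_of E ` V) < card (comp_of E ` V)"
    using assms(1) by (metis card_image_le eq_card_imp_inj_on finite_imageI le_neq_implies_less)
  then show ?thesis unfolding img ncomp_def .
qed

text \<open>A walk from \<open>x\<close> along old edges never arrives at an end of the new edge, so
  it has no occasion to use it.\<close>

lemma rtrancl_insert_edge:
  assumes "(x, y) \<in> (edge_rel (insert {u, v} E))\<^sup>*" "(x, u) \<notin> (edge_rel E)\<^sup>*" "(x, v) \<notin> (edge_rel E)\<^sup>*"
  shows "(x, y) \<in> (edge_rel E)\<^sup>*"
  using assms(1)
proof induction
  case (step y z)
  show ?case
  proof (cases "{y, z} \<in> E")
    case True
    then show ?thesis using step by (auto simp: edge_rel_def intro: rtrancl_into_rtrancl)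
  next
    case False
    then have "y = u \<or> y = v" using step by (auto simp: edge_rel_def doubleton_eq_iff)
    then show ?thesis using step assms by auto
  qed
qed simp

text \<open>Components other than those of \<open>u\<close> and \<open>v\<close> survive unchanged
  and differ from the new component of \<open>u\<close>. So at most two are replaced by one.\<close>

lemma ncomp_insert_ge:
  assumes "finite V" "u \<in> V" "v \<in> V"
  shows "ncomp V E \<le> Suc (ncomp V (insert {u, v} E))"
proof -
  let ?E = "insert {u, v} E"
  have "comp_of E ` V - {comp_of E u, comp_of E v} \<subseteq> comp_of ?E ` V - {comp_of ?E u}"
  proof
    fix X assume "X \<in> comp_of E ` V - {comp_of E u, comp_of E v}"
    then obtain x where x: "x \<in> V" "X = comp_of E x" "(x, u) \<notin> (edge_rel E)\<^sup>*" "(x, v) \<notin> (edge_rel E)\<^sup>*"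
      using comp_of_eq_iff by (metis Diff_iff imageE insertCI)
    have "comp_of ?E x = comp_of E x"
      using rtrancl_insert_edge[OF _ x(3,4)] edge_rel_mono[of E ?E] unfolding comp_of_def by auto
    moreover have "comp_of ?E x \<noteq> comp_of ?E u"
      using rtrancl_insert_edge[OF _ x(3,4)] x(3) by (auto simp: comp_of_eq_iff)
    ultimately show "X \<in> comp_of ?E ` V - {comp_of ?E u}" using x by auto
  qed
  then have "card (comp_of E ` V - {comp_of E u, comp_of E v}) \<le> card (comp_of ?E ` V - {comp_of ?E u})"
    using assms by (intro card_mono) auto
  moreover have "card (comp_of E ` V) - card {comp_of E u, comp_of E v} \<le> card (comp_of E ` V - {comp_of E u, comp_of E v})"
    by (intro diff_card_le_card_Diff) auto
  moreover have "card {comp_of E u, comp_of E v} \<le> 2" by (simp add: card_insert_if)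
  moreover have "card (comp_of ?E ` V - {comp_of ?E u}) = card (comp_of ?E ` V) - 1"
    using assms by (intro card_Diff_singleton) auto
  moreover have "card (comp_of ?E ` V) > 0" using assms by (auto simp: card_gt_0_iff)
  ultimately show ?thesis unfolding ncomp_def by linarith
qed

text \<open>Without edges every vertex is a component, and each added edge lowers the number by at
  most one.\<close>

lemma card_le_ncomp_add_edges:
  assumes "finite E" "finite V" "\<forall>e\<in>E. e \<subseteq> V \<and> card e = 2"
  shows "card V \<le> ncomp V E + card E"
  using assms(1,3)
proof (induction E)
  case empty
  have "comp_of ({} :: 'a set set) = (\<lambda>v. {v})" by (auto simp: comp_of_def edge_rel_def)
  then show ?case by (simp add: ncomp_def card_image)
next
  case (insert e E)
  obtain u v where "e = {u, v}" using insert.prems by (metis card_2_iff insertI1)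
  then show ?case using insert ncomp_insert_ge[OF assms(2), of u v E] by auto
qed

lemma ncomp_le_card: "finite V \<Longrightarrow> ncomp V E \<le> card V"
  unfolding ncomp_def by (rule card_image_le)

lemma ncomp_pos: "finite V \<Longrightarrow> V \<noteq> {} \<Longrightarrow> 0 < ncomp V E"
  unfolding ncomp_def by (auto simp: card_gt_0_iff)

section \<open>Plane graphs\<close>

definition skeleton :: "'a set \<Rightarrow> 'a set set \<Rightarrow> ('a \<Rightarrow> complex) \<Rightarrow> ('a set \<Rightarrow> real \<Rightarrow> complex) \<Rightarrow> complex set" where
  "skeleton V E p c = p ` V \<union> (\<Union>e\<in>E. path_image (c e))"

lemma finite_simple_graph_finite_edges: "finite_simple_graph V E \<Longrightarrow> finite E"
  unfolding finite_simple_graph_def by (meson PowI finite_Pow_iff finite_subset subsetI)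

lemma finite_simple_graph_subset: "finite_simple_graph V E \<Longrightarrow> E' \<subseteq> E \<Longrightarrow> finite_simple_graph V E'"
  unfolding finite_simple_graph_def by auto

lemma finite_simple_graph_edgeE:
  assumes "finite_simple_graph V E" "e \<in> E"
  obtains u v where "e = {u, v}" "u \<noteq> v" "u \<in> V" "v \<in> V"
  using assms unfolding finite_simple_graph_def by (metis card_2_iff insert_subset)

lemma plane_drawing_subset:
  assumes "plane_drawing V E p c" "V' \<subseteq> V" "E' \<subseteq> E" "\<forall>e\<in>E'. e \<subseteq> V'"
  shows "plane_drawing V' E' p c"
proof -
  from assms(1) have inj: "inj_on p V"
    and ends: "\<forall>e\<in>E. arc (c e) \<and> {pathstart (c e), pathfinish (c e)} = p ` e"
    and img: "\<forall>e\<in>E. path_image (c e) \<inter> p ` V = p ` e"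
    and meet: "\<forall>e\<in>E. \<forall>f\<in>E. e \<noteq> f \<longrightarrow> path_image (c e) \<inter> path_image (c f) \<subseteq> p ` (e \<inter> f)"
    unfolding plane_drawing_def by simp_all
  have restrict: "X \<inter> A = B \<Longrightarrow> B \<subseteq> C \<Longrightarrow> C \<subseteq> A \<Longrightarrow> X \<inter> C = B" for X A B C :: "complex set"
    by blast
  have "path_image (c e) \<inter> p ` V' = p ` e" if "e \<in> E'" for e
  proof (rule restrict)
    show "path_image (c e) \<inter> p ` V = p ` e" using img subsetD[OF assms(3) that] by simp
    show "p ` e \<subseteq> p ` V'" "p ` V' \<subseteq> p ` V" using assms(2,4) that by (simp_all add: image_mono)
  qed
  moreover have "inj_on p V'" using inj assms(2) by (rule inj_on_subset)
  ultimately show ?thesis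
    unfolding plane_drawing_def using ends meet assms(3) by (simp add: subset_iff)
qed

locale plane_graph =
  fixes V :: "'a set" and E :: "'a set set" and p :: "'a \<Rightarrow> complex" and c :: "'a set \<Rightarrow> real \<Rightarrow> complex"
  assumes graph: "finite_simple_graph V E" and drawing: "plane_drawing V E p c"
begin

abbreviation skel :: "'a set set \<Rightarrow> complex set" where "skel E' \<equiv> skeleton V E' p c"

lemma finite_V: "finite V" and finite_E: "finite E"
  using graph finite_simple_graph_finite_edges unfolding finite_simple_graph_def by auto

lemma arc_edge: "e \<in> E \<Longrightarrow> arc (c e)"
  and ends_edge: "e \<in> E \<Longrightarrow> {pathstart (c e), pathfinish (c e)} = p ` e"
  and edge_Int_vertices: "e \<in> E \<Longrightarrow> path_image (c e) \<inter> p ` V = p ` e"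
  and edge_Int_edge: "e \<in> E \<Longrightarrow> f \<in> E \<Longrightarrow> e \<noteq> f \<Longrightarrow> path_image (c e) \<inter> path_image (c f) \<subseteq> p ` (e \<inter> f)"
  using drawing unfolding plane_drawing_def by auto

lemma plane_graph_subset: "E' \<subseteq> E \<Longrightarrow> plane_graph V E' p c"
  using graph drawing finite_simple_graph_subset plane_drawing_subset[of V E p c V E']
  unfolding plane_graph_def finite_simple_graph_def by blast

lemma compact_skel: "E' \<subseteq> E \<Longrightarrow> compact (skel E')"
  unfolding skeleton_def using finite_V finite_subset[OF _ finite_E] arc_edge
  by (intro compact_Un compact_UN) (auto intro: finite_imp_compact compact_arc_image)

lemma edge_Int_skel:
  assumes "e \<in> E"
  shows "path_image (c e) \<inter> skel (E - {e}) \<subseteq> p ` e"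
  unfolding skeleton_def using edge_Int_vertices[OF assms] edge_Int_edge[OF assms] by blast

lemma skel_insert: "skel (insert e E') = skel E' \<union> path_image (c e)"
  unfolding skeleton_def by auto

lemma path_component_skel:
  assumes "(a, b) \<in> (edge_rel E')\<^sup>*" "a \<in> V" "E' \<subseteq> E"
  shows "path_component (skel E') (p a) (p b)"
  using assms(1)
proof induction
  case base
  then show ?case using assms by (auto simp: skeleton_def path_component_refl)
next
  case (step y z)
  then have e: "{y, z} \<in> E'" by (simp add: edge_rel_def)
  then have "p ` {y, z} \<subseteq> path_image (c {y, z})" using edge_Int_vertices assms by blast
  moreover have "path_connected (path_image (c {y, z}))"
    using e assms arc_edge by (meson arc_imp_path path_connected_path_image subsetD)
  ultimately have "path_component (path_image (c {y, z})) (p y) (p z)"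
    by (simp add: path_connected_component)
  then have "path_component (skel E') (p y) (p z)"
    by (rule path_component_of_subset[rotated]) (use e in \<open>auto simp: skeleton_def\<close>)
  then show ?case using step path_component_trans by metis
qed

text \<open>A walk from \<open>u\<close> to \<open>v\<close> avoiding the edge is drawn as a path in
  the remaining skeleton, and this path contains an arc with the same ends.\<close>

lemma chord_exists:
  assumes "{u, v} \<in> E" "u \<noteq> v" "(u, v) \<in> (edge_rel (E - {{u, v}}))\<^sup>*"
  obtains q where "chord (skel (E - {{u, v}})) (c {u, v}) q"
proof -
  let ?e = "{u, v}" and ?S = "skel (E - {{u, v}})"
  have uv: "u \<in> V" "v \<in> V" using graph assms unfolding finite_simple_graph_def by auto
  have ends: "{pathstart (c ?e), pathfinish (c ?e)} = {p u, p v}" using ends_edge[OF assms(1)] by simp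
  have "path_component ?S (p u) (p v)" using path_component_skel[OF assms(3) uv(1)] by simp
  then have "path_component ?S (pathfinish (c ?e)) (pathstart (c ?e))"
    using ends path_component_sym by (metis doubleton_eq_iff)
  then obtain g where g: "path g" "path_image g \<subseteq> ?S" "pathstart g = pathfinish (c ?e)"
    "pathfinish g = pathstart (c ?e)" unfolding path_component_def by auto
  moreover have "pathfinish (c ?e) \<noteq> pathstart (c ?e)" using arc_edge[OF assms(1)] arc_distinct_ends by metis
  ultimately obtain q where q: "arc q" "path_image q \<subseteq> path_image g"
    "pathstart q = pathfinish (c ?e)" "pathfinish q = pathstart (c ?e)" by (metis path_contains_arc)
  have "chord ?S (c ?e) q"
    using q g arc_edge[OF assms(1)] compact_skel[of "E - {?e}"] edge_Int_skel[OF assms(1)] ends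
    by unfold_locales auto
  then show thesis using that by blast
qed

end

section \<open>Euler's inequality for plane graphs\<close>

lemma faces_skeleton_no_edges:
  assumes "finite V"
  shows "faces (skeleton V {} p c) \<noteq> {}"
proof -
  have "- p ` V \<noteq> {}"
    using assms infinite_UNIV_char_0[where 'a = complex] by (metis double_compl Compl_empty_eq finite_imageI)
  then show ?thesis by (simp add: faces_def skeleton_def)
qed

text \<open>The finiteness assumption is needed because \<open>card\<close> of an infinite set is 0.\<close>

lemma euler_le:
  assumes "plane_graph V E p c" "finite (faces (skeleton V E p c))"
  shows "card E + ncomp V E + 1 \<le> card V + card (faces (skeleton V E p c))"
proof -
  have "finite E" using assms plane_graph.finite_E by blast
  then show ?thesis using assms
  proof (induction E)
    case empty
    then interpret plane_graph V "{}" p c by simp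
    have "0 < card (faces (skel {}))"
      using empty.prems(2) faces_skeleton_no_edges[OF finite_V] by (simp add: card_gt_0_iff)
    then show ?case using ncomp_le_card[OF finite_V, of "{}"] by simp
  next
    case (insert e E)
    interpret plane_graph V "insert e E" p c by fact
    obtain u v where e: "e = {u, v}" "u \<noteq> v" "u \<in> V" "v \<in> V"
      using finite_simple_graph_edgeE[OF graph] by blast
    have E: "insert e E - {e} = E" using insert by auto
    have pg: "plane_graph V E p c" by (rule plane_graph_subset) auto
    have arc: "arc (c e)" and cpt: "compact (skel E)" and fin: "finite (faces (skel E \<union> path_image (c e)))"
      using arc_edge compact_skel insert.prems by (auto simp: skel_insert)
    note le = card_faces_add_arc[OF arc cpt fin]
    have IH: "card E + ncomp V E + 1 \<le> card V + card (faces (skel E))"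
      using insert.IH[OF pg] le by auto
    \<comment> \<open>An edge closing a cycle adds a face and does not add a component; a bridge
      merges two components and does not lower the number of faces.\<close>
    show ?case
    proof (cases "(u, v) \<in> (edge_rel E)\<^sup>*")
      case True
      then obtain q where "chord (skel E) (c e) q" using chord_exists[of u v] e E by auto
      then have "card (faces (skel E)) < card (faces (skel (insert e E)))"
        using chord.card_faces_less fin unfolding skel_insert by blast
      moreover have "ncomp V (insert e E) \<le> ncomp V E" using ncomp_antimono finite_V by blast
      ultimately show ?thesis using IH insert.hyps by simp
    next
      case False
      then have "ncomp V (insert e E) < ncomp V E" using ncomp_insert_bridge finite_V e by metis
      then show ?thesis using IH le insert.hyps by (simp add: skel_insert)
    qed
  qed
qed

section \<open>Incidences of faces and edges, and the edge bound\<close>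

context plane_graph
begin

text \<open>Subtracting the rest of the skeleton leaves the arc without its ends, so that touching a
  vertex does not count as incidence.\<close>

definition inc :: "complex set \<Rightarrow> 'a set set" where
  "inc f = {e \<in> E. frontier f \<inter> (path_image (c e) - skel (E - {e})) \<noteq> {}}"

text \<open>A frontier point off the skeleton would lie in an open face meeting \<open>f\<close>,
  hence in \<open>f\<close>, which is open and so misses its frontier. A point on an edge is either
  one of its ends or witnesses incidence.\<close>

lemma frontier_face:
  assumes "f \<in> faces (skel E)"
  shows "frontier f \<subseteq> p ` V \<union> (\<Union>e\<in>inc f. path_image (c e))"
proof
  fix x assume x: "x \<in> frontier f"
  have "x \<in> skel E"
  proof (rule ccontr)
    assume "x \<notin> skel E"
    then obtain g where g: "g \<in> faces (skel E)" "x \<in> g" by (rule faceE)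
    have "open f" "open g" using assms g face_open compact_skel by blast+
    then have "g \<inter> f \<noteq> {}" "x \<notin> f" using x g open_Int_closure_eq_empty[of g f]
      by (auto simp: frontier_def interior_open)
    then show False using faces_disjoint[OF g(1) assms] g by auto
  qed
  then consider "x \<in> p ` V" | e where "e \<in> E" "x \<in> path_image (c e)" unfolding skeleton_def by auto
  then show "x \<in> p ` V \<union> (\<Union>e\<in>inc f. path_image (c e))"
  proof cases
    case 2
    show ?thesis
    proof (cases "x \<in> skel (E - {e})")
      case True
      then show ?thesis using edge_Int_skel[OF 2(1)] edge_Int_vertices[OF 2(1)] 2 by blast
    next
      case False
      then show ?thesis using 2 x unfolding inc_def by auto
    qed
  qed auto
qed

text \<open>Two distinct edges share at most one end, so their arcs share at most one point and
  \<open>connected_complement_two_arcs\<close> applies; the vertices are removed as a finite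
  set.\<close>

lemma connected_complement_two_edges:
  assumes "I \<subseteq> E" "card I \<le> 2"
  shows "connected (- (p ` V \<union> (\<Union>e\<in>I. path_image (c e))))"
proof -
  have "finite I" using assms finite_E finite_subset by blast
  have "connected (- (\<Union>e\<in>I. path_image (c e)))"
  proof -
    consider "card I = 0" | "card I = 1" | "card I = 2" using assms by linarith
    then show ?thesis
    proof cases
      case 1
      then show ?thesis using \<open>finite I\<close> by (simp add: connected_UNIV)
    next
      case 2
      then obtain d where "I = {d}" by (metis card_1_singletonE)
      then show ?thesis using arc_edge assms by (simp add: connected_arc_complement)
    next
      case 3
      then obtain d d' where d: "I = {d, d'}" "d \<noteq> d'" by (metis card_2_iff)
      have dd: "d \<in> E" "d' \<in> E" using d assms by auto
      have "\<exists>a. d \<inter> d' \<subseteq> {a}"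
      proof -
        have "card d = 2" "card d' = 2" "finite d'"
          using dd graph unfolding finite_simple_graph_def by (auto intro: finite_subset)
        then have "\<not> d' \<subseteq> d" using d(2) by (metis card_subset_eq card.infinite zero_neq_numeral)
        then have "card (d \<inter> d') < card d'" using \<open>finite d'\<close> by (intro psubset_card_mono) auto
        then have "card (d \<inter> d') \<le> 1" using \<open>card d' = 2\<close> by simp
        then show ?thesis using \<open>finite d'\<close> by (metis card_le_Suc0_iff_eq One_nat_def finite_Int insertI1 subsetI)
      qed
      then obtain a where "d \<inter> d' \<subseteq> {a}" ..
      then have "path_image (c d) \<inter> path_image (c d') \<subseteq> {p a}"
        using edge_Int_edge[OF dd d(2)] by blast
      then have "connected (- (path_image (c d) \<union> path_image (c d') \<union> {}))"
        using arc_edge dd by (intro connected_complement_two_arcs) auto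
      then show ?thesis using d by (simp add: Un_commute)
    qed
  qed
  moreover have "open (- (\<Union>e\<in>I. path_image (c e)))"
    using \<open>finite I\<close> assms arc_edge by (intro open_Compl closed_UN) (auto intro: closed_arc_image)
  ultimately have "connected (- (\<Union>e\<in>I. path_image (c e)) - p ` V)"
    using finite_V by (intro connected_open_delete_finite) auto
  then show ?thesis by (simp add: Diff_eq Int_commute)
qed

text \<open>A face with at most two incident edges would have its frontier in a set with connected
  complement, hence be the only face; but an edge on a cycle separates two faces.\<close>

lemma card_inc_ge_3:
  assumes "E \<noteq> {}" and f: "f \<in> faces (skel E)"
    and bridgeless: "\<And>u v. {u, v} \<in> E \<Longrightarrow> (u, v) \<in> (edge_rel (E - {{u, v}}))\<^sup>*"
  shows "3 \<le> card (inc f)"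
proof (rule ccontr)
  assume "\<not> 3 \<le> card (inc f)"
  then have le: "card (inc f) \<le> 2" by simp
  let ?K = "p ` V \<union> (\<Union>e\<in>inc f. path_image (c e))"
  have inc: "inc f \<subseteq> E" unfolding inc_def by auto
  then have K: "?K \<subseteq> skel E" unfolding skeleton_def by auto
  have fK: "f \<inter> ?K = {}" using face_disjnt[OF f] K by auto
  \<comment> \<open>A connected set that meets \<open>f\<close> but not its frontier cannot leave
    \<open>f\<close>.\<close>
  have "- ?K \<subseteq> f"
  proof (rule ccontr)
    assume "\<not> - ?K \<subseteq> f"
    then have "- ?K - f \<noteq> {}" by blast
    moreover have "- ?K \<inter> f \<noteq> {}" using fK face_nonempty[OF f] by blast
    ultimately have "- ?K \<inter> frontier f \<noteq> {}"
      using connected_Int_frontier[OF connected_complement_two_edges[OF inc le]] by blast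
    then show False using frontier_face[OF f] by blast
  qed
  then have f_all: "- skel E \<subseteq> f" using K by blast
  have "faces (skel E) = {f}"
  proof -
    have "g = f" if g: "g \<in> faces (skel E)" for g
    proof -
      have "g \<inter> f \<noteq> {}" using face_disjnt[OF g] face_nonempty[OF g] f_all by blast
      then show ?thesis using faces_disjoint[OF g f] by blast
    qed
    then show ?thesis using f by blast
  qed
  obtain e where e: "e \<in> E" using assms by auto
  then obtain u v where uv: "e = {u, v}" "u \<noteq> v" using finite_simple_graph_edgeE[OF graph] by metis
  obtain q where q: "chord (skel (E - {e})) (c e) q"
    using chord_exists[of u v] bridgeless[of u v] e uv by auto
  have sk: "skel (E - {e}) \<union> path_image (c e) = skel E"
    using skel_insert[of e "E - {e}"] e by (simp add: insert_absorb)
  have "card (faces (skel (E - {e}))) < card (faces (skel E))"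
    using chord.card_faces_less[OF q] \<open>faces (skel E) = {f}\<close> unfolding sk by simp
  then have "card (faces (skel (E - {e}))) = 0" using \<open>faces (skel E) = {f}\<close> by simp
  \<comment> \<open>Finiteness ensures that cardinality 0 means that there is no face.\<close>
  moreover have "finite (faces (skel (E - {e})))"
    using card_faces_add_arc(1)[OF arc_edge[OF e] compact_skel] sk \<open>faces (skel E) = {f}\<close> by auto
  ultimately have "faces (skel (E - {e})) = {}" by simp
  moreover obtain h where "h \<in> faces (skel (E - {e}))"
    using face_superface[of f "skel (E - {e})" "path_image (c e)"] f unfolding sk by blast
  ultimately show False by simp
qed

text \<open>Counting incidences twice, at least 3 edges per face and at most 2 faces per edge, gives
  3 \<open>card ?F\<close> \<le> 2 \<open>card E\<close>; this is combined with three times Euler's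
  inequality.\<close>

lemma bridgeless_edge_bound:
  assumes "E \<noteq> {}"
    and bridgeless: "\<And>u v. {u, v} \<in> E \<Longrightarrow> (u, v) \<in> (edge_rel (E - {{u, v}}))\<^sup>*"
  shows "card E + 3 * ncomp V E \<le> 3 * card V"
proof -
  let ?F = "faces (skel E)"
  have ge: "3 \<le> card (inc f)" if "f \<in> ?F" for f using card_inc_ge_3[OF assms(1) that bridgeless] .
  have faces_edge: "finite {f \<in> ?F. e \<in> inc f} \<and> card {f \<in> ?F. e \<in> inc f} \<le> 2" if e: "e \<in> E" for e
  proof -
    obtain u v where uv: "e = {u, v}" "u \<noteq> v" using finite_simple_graph_edgeE[OF graph e] by metis
    obtain q where q: "chord (skel (E - {e})) (c e) q"
      using chord_exists[of u v] bridgeless[of u v] e uv by auto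
    have sk: "skel (E - {e}) \<union> path_image (c e) = skel E"
      using skel_insert[of e "E - {e}"] e by (simp add: insert_absorb)
    show ?thesis using chord.card_incident_faces[OF q] e unfolding sk inc_def by simp
  qed
  \<comment> \<open>Each face is incident to some edge, and each of the finitely many edges to
    finitely many faces; \<open>euler_le\<close> asks for this finiteness.\<close>
  have "?F \<subseteq> (\<Union>e\<in>E. {f \<in> ?F. e \<in> inc f})"
  proof
    fix f assume f: "f \<in> ?F"
    then have "inc f \<noteq> {}" using ge[OF f] by auto
    then show "f \<in> (\<Union>e\<in>E. {f \<in> ?F. e \<in> inc f})" using f unfolding inc_def by blast
  qed
  then have fin: "finite ?F" using finite_E faces_edge finite_subset by (metis (no_types, lifting) finite_UN_I)
  have "3 * card ?F = (\<Sum>f\<in>?F. 3)" by simp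
  also have "\<dots> \<le> (\<Sum>f\<in>?F. card {e \<in> E. e \<in> inc f})"
  proof (rule sum_mono)
    fix f assume "f \<in> ?F"
    moreover have "{e \<in> E. e \<in> inc f} = inc f" by (auto simp: inc_def)
    ultimately show "3 \<le> card {e \<in> E. e \<in> inc f}" using ge by simp
  qed
  also have "\<dots> = (\<Sum>e\<in>E. card {f \<in> ?F. e \<in> inc f})"
    by (rule sum_multicount_gen) (use fin finite_E in auto)
  also have "\<dots> \<le> (\<Sum>e\<in>E. 2)" using faces_edge by (intro sum_mono) auto
  finally have "3 * card ?F \<le> 2 * card E" by simp
  then show ?thesis using euler_le[OF _ fin] plane_graph_axioms by fastforce
qed

end

text \<open>Deleting a bridge loses one edge and gains a component, so the bound for the smaller
  graph more than suffices.\<close>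

lemma plane_graph_edge_bound:
  assumes "plane_graph V E p c"
  shows "card E + 3 * ncomp V E \<le> 3 * card V"
  using assms
proof (induction "card E" arbitrary: E rule: less_induct)
  case less
  interpret plane_graph V E p c by fact
  show ?case
  proof (cases "\<exists>u v. {u, v} \<in> E \<and> (u, v) \<notin> (edge_rel (E - {{u, v}}))\<^sup>*")
    case True
    then obtain u v where uv: "{u, v} \<in> E" "(u, v) \<notin> (edge_rel (E - {{u, v}}))\<^sup>*" by auto
    let ?E = "E - {{u, v}}"
    have card: "Suc (card ?E) = card E" using uv finite_E by (metis card.remove)
    have "card ?E + 3 * ncomp V ?E \<le> 3 * card V"
      using card plane_graph_subset[of ?E] by (intro less.hyps) auto
    moreover have "u \<in> V" "v \<in> V" using uv graph unfolding finite_simple_graph_def by auto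
    then have "ncomp V (insert {u, v} ?E) < ncomp V ?E" using ncomp_insert_bridge[OF finite_V] uv by metis
    moreover have "insert {u, v} ?E = E" using uv by auto
    ultimately show ?thesis using card by simp
  next
    case False
    then show ?thesis
      using bridgeless_edge_bound ncomp_le_card[OF finite_V, of E] by (cases "E = {}") auto
  qed
qed

section \<open>Maximum matchings\<close>

text \<open>Maximality relative to a vertex set \<open>U\<close> stands for a maximum matching of
  the induced subgraph, so vertices can be deleted while the edge set \<open>E\<close> stays
  fixed.\<close>

definition max_in :: "'a set set \<Rightarrow> 'a set \<Rightarrow> 'a set set \<Rightarrow> bool" where
  "max_in E U M \<longleftrightarrow> matching E M \<and> \<Union>M \<subseteq> U \<and>
     (\<forall>M'. matching E M' \<longrightarrow> \<Union>M' \<subseteq> U \<longrightarrow> card M' \<le> card M)"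

text \<open>The set usually called D in the Gallai--Edmonds decomposition of the graph induced on
  \<open>U\<close>.\<close>

definition missable :: "'a set set \<Rightarrow> 'a set \<Rightarrow> 'a set" where
  "missable E U = {v \<in> U. \<exists>M. max_in E U M \<and> v \<notin> \<Union>M}"

section \<open>Matchings and their exchange along components\<close>

locale simple_edges =
  fixes E :: "'a set set"
  assumes fin_E: "finite E" and card_edge: "e \<in> E \<Longrightarrow> card e = 2"
begin

lemma matching_finite: "matching E M \<Longrightarrow> finite M"
  unfolding matching_def using fin_E finite_subset by blast

lemma finite_edge: "e \<in> E \<Longrightarrow> finite e"
  using card_edge by (metis card.infinite zero_neq_numeral)

lemma matching_edge: "matching E M \<Longrightarrow> e \<in> M \<Longrightarrow> e \<in> E"
  unfolding matching_def by blast

lemma matching_finite_Union: "matching E M \<Longrightarrow> finite (\<Union>M)"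
  using matching_finite matching_edge finite_edge by blast

lemma matching_disjoint: "matching E M \<Longrightarrow> e \<in> M \<Longrightarrow> f \<in> M \<Longrightarrow> x \<in> e \<Longrightarrow> x \<in> f \<Longrightarrow> e = f"
  unfolding matching_def pairwise_def disjnt_def by blast

lemma card_Union_matching:
  assumes "matching E M"
  shows "card (\<Union>M) = 2 * card M"
proof -
  have "card (\<Union>M) = (\<Sum>e\<in>M. card e)"
    using assms matching_edge finite_edge by (intro card_Union_disjoint) (auto simp: matching_def)
  also have "\<dots> = (\<Sum>e\<in>M. 2)"
    using assms matching_edge card_edge by (intro sum.cong) auto
  finally show ?thesis by simp
qed

lemma matching_subset: "matching E M \<Longrightarrow> M' \<subseteq> M \<Longrightarrow> matching E M'"
  unfolding matching_def by (meson pairwise_subset subset_trans)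

lemma matching_insert:
  assumes "matching E M" "e \<in> E" "e \<inter> \<Union>M = {}"
  shows "matching E (insert e M)" "card (insert e M) = Suc (card M)"
proof -
  show "matching E (insert e M)"
    using assms unfolding matching_def pairwise_insert disjnt_def by blast
  have "e \<noteq> {}" using card_edge[OF assms(2)] by auto
  then have "e \<notin> M" using assms(3) by auto
  then show "card (insert e M) = Suc (card M)" using matching_finite[OF assms(1)] by simp
qed

lemma matching_remove:
  assumes "matching E M" "e \<in> M"
  shows "matching E (M - {e})" "\<Union>(M - {e}) = \<Union>M - e" "Suc (card (M - {e})) = card M"
proof -
  show "matching E (M - {e})" using matching_subset[OF assms(1)] by blast
  show "\<Union>(M - {e}) = \<Union>M - e" using matching_disjoint[OF assms(1)] assms(2) by blast
  show "Suc (card (M - {e})) = card M" using matching_finite[OF assms(1)] assms(2) by (metis card.remove)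
qed

lemma matching_remove_vertex:
  assumes "matching E M" "\<Union>M \<subseteq> U"
  obtains M' where "matching E M'" "\<Union>M' \<subseteq> U - {a}" "\<Union>M' \<subseteq> \<Union>M" "card M \<le> Suc (card M')"
proof (cases "a \<in> \<Union>M")
  case True
  then obtain e where e: "e \<in> M" "a \<in> e" by blast
  show thesis using that[of "M - {e}"] matching_remove[OF assms(1) e(1)] e assms(2) by auto
next
  case False
  then show thesis using assms by (intro that[of M]) auto
qed

lemma max_in_exists: obtains M where "max_in E U M"
proof -
  let ?P = "\<lambda>M. matching E M \<and> \<Union>M \<subseteq> U"
  have "?P {}" by (simp add: matching_def)
  moreover have "\<forall>M. ?P M \<longrightarrow> card M < Suc (card E)"
    using card_mono[OF fin_E] by (simp add: matching_def le_imp_less_Suc)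
  ultimately obtain M where "?P M" "\<forall>M'. ?P M' \<longrightarrow> card M' \<le> card M"
    using ex_has_greatest_nat[of ?P "{}" card "Suc (card E)"] by metis
  then show thesis using that[of M] unfolding max_in_def by simp
qed

lemma max_in_card_le: "max_in E U M \<Longrightarrow> matching E N \<Longrightarrow> \<Union>N \<subseteq> U \<Longrightarrow> card N \<le> card M"
  unfolding max_in_def by simp

lemma max_in_card_eq: "max_in E U M \<Longrightarrow> max_in E U N \<Longrightarrow> card M = card N"
  unfolding max_in_def by (simp add: le_antisym)

lemma max_inI: "max_in E U M \<Longrightarrow> matching E N \<Longrightarrow> \<Union>N \<subseteq> U \<Longrightarrow> card M \<le> card N \<Longrightarrow> max_in E U N"
  unfolding max_in_def by (meson le_trans)

lemma max_in_no_edge: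
  assumes "max_in E U M" "e \<in> E" "e \<subseteq> U"
  shows "e \<inter> \<Union>M \<noteq> {}"
proof
  assume "e \<inter> \<Union>M = {}"
  then have "matching E (insert e M)" "card (insert e M) = Suc (card M)"
    using matching_insert assms unfolding max_in_def by auto
  moreover have "\<Union>(insert e M) \<subseteq> U" using assms by (simp add: max_in_def)
  ultimately show False using max_in_card_le[OF assms(1), of "insert e M"] by simp
qed

text \<open>When \<open>X\<close> is a component of \<open>M \<union> N\<close>, this is the usual
  exchange along an alternating path or cycle.\<close>

definition switch :: "'a set set \<Rightarrow> 'a set set \<Rightarrow> 'a set \<Rightarrow> 'a set set" where
  "switch M N X = {e \<in> M. e \<inter> X = {}} \<union> {e \<in> N. e \<subseteq> X}"

text \<open>Nothing changes outside \<open>X\<close>, so the sizes differ only through the vertices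
  covered in \<open>X\<close>. The equation counts the missed ones, of which a component of two
  matchings has few.\<close>

lemma switch:
  assumes "matching E M" "matching E N" "\<forall>e\<in>M \<union> N. e \<subseteq> X \<or> e \<inter> X = {}"
  shows "matching E (switch M N X)" "\<Union>(switch M N X) = (\<Union>M - X) \<union> (\<Union>N \<inter> X)"
    and "finite X \<Longrightarrow> 2 * card (switch M N X) + card (X - \<Union>N) = 2 * card M + card (X - \<Union>M)"
proof -
  show 1: "matching E (switch M N X)"
  proof -
    have "disjnt e f" if ef: "e \<in> switch M N X" "f \<in> switch M N X" "e \<noteq> f" for e f
    proof -
      consider "e \<in> M \<and> f \<in> M" | "e \<in> N \<and> f \<in> N" | "e \<inter> X = {} \<and> f \<subseteq> X" | "e \<subseteq> X \<and> f \<inter> X = {}"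
        using ef(1,2) unfolding switch_def by blast
      then show ?thesis
      proof cases
        case 1
        then show ?thesis using assms(1) ef(3) by (meson matching_def pairwiseD)
      next
        case 2
        then show ?thesis using assms(2) ef(3) by (meson matching_def pairwiseD)
      qed (auto simp: disjnt_def)
    qed
    moreover have "switch M N X \<subseteq> E" using assms(1,2) unfolding switch_def matching_def by auto
    ultimately show ?thesis unfolding matching_def pairwise_def by simp
  qed
  show 2: "\<Union>(switch M N X) = (\<Union>M - X) \<union> (\<Union>N \<inter> X)"
  proof (intro equalityI subsetI)
    fix x assume "x \<in> (\<Union>M - X) \<union> (\<Union>N \<inter> X)"
    then consider e where "e \<in> M" "x \<in> e" "x \<notin> X" | e where "e \<in> N" "x \<in> e" "x \<in> X" by blast
    then show "x \<in> \<Union>(switch M N X)"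
      using assms(3) unfolding switch_def by cases blast+
  qed (auto simp: switch_def)
  assume X: "finite X"
  have "2 * card (switch M N X) = card ((\<Union>M - X) \<union> (\<Union>N \<inter> X))"
    using card_Union_matching[OF 1] 2 by simp
  also have "\<dots> = card (\<Union>M - X) + card (\<Union>N \<inter> X)"
    using X matching_finite_Union[OF assms(1)] by (intro card_Un_disjoint) auto
  finally have a: "2 * card (switch M N X) = card (\<Union>M - X) + card (\<Union>N \<inter> X)" .
  have b: "2 * card M = card (\<Union>M - X) + card (\<Union>M \<inter> X)"
    using card_Union_matching[OF assms(1)] card_Int_Diff[OF matching_finite_Union[OF assms(1)], of X]
    by simp
  have c: "card (S \<inter> X) + card (X - S) = card X" for S :: "'a set"
    using X by (metis Int_commute card_Int_Diff)
  show "2 * card (switch M N X) + card (X - \<Union>N) = 2 * card M + card (X - \<Union>M)"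
    using a b c[of "\<Union>M"] c[of "\<Union>N"] by linarith
qed

lemma comp_of_closed:
  assumes "F \<subseteq> E" "e \<in> F"
  shows "e \<subseteq> comp_of F x \<or> e \<inter> comp_of F x = {}"
proof -
  obtain u v where uv: "e = {u, v}" using card_edge assms by (metis card_2_iff subsetD)
  have "(u, v) \<in> edge_rel F" "(v, u) \<in> edge_rel F"
    using assms uv by (auto simp: edge_rel_def insert_commute)
  then show ?thesis using uv unfolding comp_of_def by (auto intro: rtrancl_into_rtrancl)
qed

lemma finite_comp_of: "F \<subseteq> E \<Longrightarrow> finite (comp_of F x)"
proof -
  assume F: "F \<subseteq> E"
  have "comp_of F x \<subseteq> insert x (\<Union>F)"
  proof
    fix y assume "y \<in> comp_of F x"
    then have "(x, y) \<in> (edge_rel F)\<^sup>*" by (simp add: comp_of_def)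
    then show "y \<in> insert x (\<Union>F)" by cases (auto simp: edge_rel_def)
  qed
  moreover have "finite (\<Union>F)" using F fin_E finite_edge finite_subset by blast
  ultimately show ?thesis by (meson finite.insertI finite_subset)
qed

text \<open>A connected graph with n vertices has at least n - 1 edges. Walks from \<open>x\<close>
  use only edges inside its component, so the component is connected by its own edges.\<close>

lemma card_comp_of_le:
  assumes "F \<subseteq> E"
  shows "card (comp_of F x) \<le> Suc (card {e \<in> F. e \<subseteq> comp_of F x})"
proof -
  let ?X = "comp_of F x" and ?F = "{e \<in> F. e \<subseteq> comp_of F x}"
  have "comp_of ?F y = comp_of ?F x" if "y \<in> ?X" for y
  proof -
    have "(x, y) \<in> (edge_rel F)\<^sup>*" using that by (simp add: comp_of_def)
    then have "(x, y) \<in> (edge_rel ?F)\<^sup>*"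
    proof induction
      case (step y z)
      then have "{y, z} \<in> ?F" by (auto simp: comp_of_def edge_rel_def intro: rtrancl_into_rtrancl)
      then show ?case using step by (auto simp: edge_rel_def intro: rtrancl_into_rtrancl)
    qed simp
    then show ?thesis using comp_of_eq_iff by metis
  qed
  then have "comp_of ?F ` ?X \<subseteq> {comp_of ?F x}" by blast
  then have "card (comp_of ?F ` ?X) \<le> card {comp_of ?F x}" by (intro card_mono) simp_all
  then have "ncomp ?X ?F \<le> 1" by (simp add: ncomp_def)
  moreover have "finite ?F" using assms fin_E by (simp add: finite_subset)
  then have "card ?X \<le> ncomp ?X ?F + card ?F"
    using finite_comp_of[OF assms, of x] card_edge assms
    by (intro card_le_ncomp_add_edges) (simp_all add: subset_iff)
  ultimately show ?thesis by linarith
qed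

text \<open>A component of the union of two matchings is a path or a cycle, so it has at most two
  ends; counting edges in a connected graph yields this without walking along the path.\<close>

lemma comp_of_Un_matchings:
  fixes x
  assumes "matching E M" "matching E N"
  defines "X \<equiv> comp_of (M \<union> N) x"
  shows "card (X - \<Union>M) + card (X - \<Union>N) \<le> 2"
proof -
  have F: "M \<union> N \<subseteq> E" using assms unfolding matching_def by auto
  have X: "finite X" unfolding X_def by (rule finite_comp_of[OF F])
  have half: "card (X - \<Union>K) + 2 * card {e \<in> K. e \<subseteq> X} = card X"
    if K: "matching E K" "K \<subseteq> M \<union> N" for K
  proof -
    have "\<Union>{e \<in> K. e \<subseteq> X} = X \<inter> \<Union>K"
      using comp_of_closed[OF F, of _ x] K(2) unfolding X_def by blast
    moreover have "matching E {e \<in> K. e \<subseteq> X}" by (rule matching_subset[OF K(1)]) auto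
    ultimately have "2 * card {e \<in> K. e \<subseteq> X} = card (X \<inter> \<Union>K)" using card_Union_matching by fastforce
    then show ?thesis using card_Int_Diff[OF X, of "\<Union>K"] by simp
  qed
  have "{e \<in> M \<union> N. e \<subseteq> X} = {e \<in> M. e \<subseteq> X} \<union> {e \<in> N. e \<subseteq> X}" by auto
  then have "card {e \<in> M \<union> N. e \<subseteq> X} \<le> card {e \<in> M. e \<subseteq> X} + card {e \<in> N. e \<subseteq> X}"
    by (simp only: card_Un_le)
  then have "card X \<le> Suc (card {e \<in> M. e \<subseteq> X} + card {e \<in> N. e \<subseteq> X})"
    using card_comp_of_le[OF F, of x] unfolding X_def by linarith
  \<comment> \<open>With m and n edges in \<open>X\<close>, the two instances of \<open>half\<close>
    add up to 2 \<open>card X\<close> - 2(m + n) missed vertices, which is at most 2.\<close>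
  then show ?thesis using half[OF assms(1) Un_upper1] half[OF assms(2) Un_upper2] by linarith
qed

lemma missable_iff: "x \<in> missable E U \<longleftrightarrow> x \<in> U \<and> (\<exists>M. max_in E U M \<and> x \<notin> \<Union>M)"
  unfolding missable_def by simp

section \<open>Stability: deleting a neighbour of a missable vertex\<close>

context
  fixes U a d
  assumes a: "a \<in> U" "a \<notin> missable E U" and d: "d \<in> missable E U" and ad: "{a, d} \<in> E"
begin

text \<open>Deleting one vertex costs at most one edge; were none lost, \<open>N\<close> would be
  maximum in \<open>U\<close> and miss \<open>a\<close>.\<close>

lemma max_in_remove_card:
  assumes M: "max_in E U M" and N: "max_in E (U - {a}) N"
  shows "card M = Suc (card N)"
proof -
  obtain M' where M': "matching E M'" "\<Union>M' \<subseteq> U - {a}" "card M \<le> Suc (card M')"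
    using matching_remove_vertex[of M U a] M unfolding max_in_def by metis
  then have "card M \<le> Suc (card N)" using max_in_card_le[OF N M'(1,2)] by simp
  moreover have "\<not> card M \<le> card N"
  proof
    assume "card M \<le> card N"
    then have "max_in E U N" using N max_inI[OF M, of N] unfolding max_in_def by auto
    then show False using a N unfolding missable_iff max_in_def by blast
  qed
  ultimately show ?thesis by simp
qed

text \<open>The stability lemma of Gallai and Edmonds. For the harder inclusion, \<open>M\<close>
  misses \<open>d\<close> and \<open>N\<close> misses \<open>x\<close> and \<open>a\<close>;
  switching on the component of \<open>x\<close> in \<open>M \<union> N\<close> produces a maximum
  matching of \<open>U\<close> missing \<open>x\<close> or \<open>a\<close>, both
  impossible.\<close>

lemma missable_remove: "missable E (U - {a}) = missable E U"
proof
  obtain N0 where N0: "max_in E (U - {a}) N0" by (rule max_in_exists)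
  obtain M where M: "max_in E U M" "d \<notin> \<Union>M" using d unfolding missable_iff by blast
  note cardMN = max_in_remove_card
  show "missable E U \<subseteq> missable E (U - {a})"
  proof
    fix x assume x: "x \<in> missable E U"
    then obtain K where K: "max_in E U K" "x \<notin> \<Union>K" unfolding missable_iff by blast
    obtain K' where K': "matching E K'" "\<Union>K' \<subseteq> U - {a}" "\<Union>K' \<subseteq> \<Union>K" "card K \<le> Suc (card K')"
      using matching_remove_vertex[of K U a] K unfolding max_in_def by metis
    have "max_in E (U - {a}) K'"
      using max_inI[OF N0 K'(1,2)] K'(4) cardMN[OF K(1) N0] by simp
    then show "x \<in> missable E (U - {a})" using K K'(3) x a unfolding missable_iff by blast
  qed
  show "missable E (U - {a}) \<subseteq> missable E U"
  proof (rule subsetI, rule ccontr)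
    fix x assume x: "x \<in> missable E (U - {a})" and xU: "x \<notin> missable E U"
    then obtain N where N: "max_in E (U - {a}) N" "x \<notin> \<Union>N" unfolding missable_iff by blast
    have MN: "matching E M" "matching E N" "\<Union>M \<subseteq> U" "\<Union>N \<subseteq> U - {a}"
      using M N unfolding max_in_def by auto
    note cMN = cardMN[OF M(1) N(1)]
    define X where "X = comp_of (M \<union> N) x"
    have F: "M \<union> N \<subseteq> E" using MN unfolding matching_def by auto
    have X: "finite X" "x \<in> X" "\<forall>e\<in>M \<union> N. e \<subseteq> X \<or> e \<inter> X = {}"
      unfolding X_def using finite_comp_of[OF F] comp_of_closed[OF F] by (auto simp: comp_of_def)
    have X': "\<forall>e\<in>N \<union> M. e \<subseteq> X \<or> e \<inter> X = {}" using X(3) by (simp add: Un_commute)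
    note sw = switch[OF MN(1,2) X(3)] and sw' = switch[OF MN(2,1) X']
    have le2: "card (X - \<Union>M) + card (X - \<Union>N) \<le> 2"
      unfolding X_def by (rule comp_of_Un_matchings[OF MN(1,2)])
    have xd: "x \<in> U" "x \<noteq> a" "x \<noteq> d" using x xU d unfolding missable_iff by auto
    have no_max: False if "matching E K" "\<Union>K \<subseteq> U" "card M \<le> card K" "x \<notin> \<Union>K" for K
      using max_inI[OF M(1) that(1-3)] that(4) xU xd unfolding missable_iff by blast
    have swU: "\<Union>(switch M N X) \<subseteq> U" and xsw: "x \<notin> \<Union>(switch M N X)"
      unfolding sw(2) using MN(3,4) N(2) X(2) by auto
    have "\<not> card M \<le> card (switch M N X)"
      using no_max[OF sw(1) swU _ xsw] by blast
    then have lt: "card (switch M N X) < card M" by simp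
    \<comment> \<open>By the equation for \<open>switch\<close> the difference is positive and even;
      as the sum is at most 2, only the values 0 and 2 remain.\<close>
    then have "card (X - \<Union>M) < card (X - \<Union>N)" "even (card (X - \<Union>N) - card (X - \<Union>M))"
      using sw(3)[OF X(1)] by presburger+
    then have cards: "card (X - \<Union>M) = 0" "card (X - \<Union>N) = 2" using le2 by presburger+
    then have XM: "X \<subseteq> \<Union>M" using X(1) by auto
    then have dX: "d \<notin> X" using M(2) by auto
    show False
    proof (cases "a \<in> X")
      case True
      \<comment> \<open>The switched matching is one edge short and misses both \<open>a\<close> and
        \<open>d\<close>; their edge restores the size and leaves \<open>x\<close> missed.\<close>
      let ?K = "insert {a, d} (switch M N X)"
      have disj: "{a, d} \<inter> \<Union>(switch M N X) = {}" unfolding sw(2) using True dX M(2) MN(4) by auto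
      have K: "card M \<le> card ?K" "matching E ?K"
        using matching_insert[OF sw(1) ad disj] sw(3)[OF X(1)] cards by simp_all
      have "\<Union>?K \<subseteq> U" using swU a d unfolding missable_iff by simp
      moreover have "x \<notin> \<Union>?K" using xd xsw by simp
      ultimately show False using no_max[OF K(2) _ K(1)] by blast
    next
      case False
      \<comment> \<open>Switching the other way gains the edge that \<open>N\<close> lacks, still
        without covering \<open>a\<close>.\<close>
      have "card (switch N M X) = card M" using sw'(3)[OF X(1)] cards cMN by simp
      moreover have sub: "\<Union>(switch N M X) \<subseteq> U - {a}" unfolding sw'(2) using MN(3,4) False by auto
      ultimately have "max_in E U (switch N M X)" by (intro max_inI[OF M(1) sw'(1)]) auto
      moreover have "a \<notin> \<Union>(switch N M X)" using sub by blast
      ultimately show False using a unfolding missable_iff by blast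
    qed
  qed
qed

end

text \<open>Stability is iterated: the missable set never changes, so the vertices still to be
  deleted keep satisfying its hypotheses.\<close>

lemma missable_remove_set:
  assumes "finite B" "B \<subseteq> U" "\<And>a. a \<in> B \<Longrightarrow> a \<notin> missable E U \<and> (\<exists>d\<in>missable E U. {a, d} \<in> E)"
    and M: "max_in E U M"
  shows "missable E (U - B) = missable E U \<and> (\<forall>N. max_in E (U - B) N \<longrightarrow> card M = card N + card B)"
  using assms(1-3)
proof (induction B)
  case empty
  then show ?case using max_in_card_eq[OF M] by auto
next
  case (insert a B)
  then have IH: "missable E (U - B) = missable E U" "\<And>N. max_in E (U - B) N \<Longrightarrow> card M = card N + card B"
    by auto
  obtain d where d: "d \<in> missable E U" "{a, d} \<in> E" using insert.prems by blast
  have a: "a \<in> U - B" "a \<notin> missable E (U - B)" "d \<in> missable E (U - B)"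
    using insert d IH by auto
  have U: "U - insert a B = U - B - {a}" by auto
  obtain N' where N': "max_in E (U - B) N'" by (rule max_in_exists)
  show ?case
    unfolding U using missable_remove[OF a d(2)] max_in_remove_card[OF a d(2) N'] IH N' insert.hyps
    by auto
qed

text \<open>Gallai's lemma: the matching missing \<open>t\<close> is chosen to share as many edges as possible
  with \<open>M\<close>.\<close>

lemma missable_exchange:
  assumes M: "max_in E W M" and uv: "u \<notin> \<Union>M" "v \<notin> \<Union>M" "u \<noteq> v" and t: "t \<in> missable E W"
  shows "\<exists>N. max_in E W N \<and> t \<notin> \<Union>N \<and> (u \<notin> \<Union>N \<or> v \<notin> \<Union>N)"
proof (rule ccontr)
  assume none: "\<not> ?thesis"
  have cover: "u \<in> \<Union>N \<and> v \<in> \<Union>N" if "max_in E W N" "t \<notin> \<Union>N" for N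
    using none that by metis
  let ?P = "\<lambda>N. max_in E W N \<and> t \<notin> \<Union>N"
  have finM: "finite M" using M matching_finite[of M] by (simp add: max_in_def)
  obtain N0 where "?P N0" using t unfolding missable_iff by metis
  moreover have "\<forall>N. ?P N \<longrightarrow> card (M \<inter> N) < Suc (card M)"
    using card_mono[OF finM Int_lower1] by (simp add: le_imp_less_Suc)
  ultimately have "\<exists>N. ?P N \<and> (\<forall>N'. ?P N' \<longrightarrow> card (M \<inter> N') \<le> card (M \<inter> N))"
    by (rule ex_has_greatest_nat[of ?P N0 "\<lambda>N. card (M \<inter> N)" "Suc (card M)"])
  then obtain N where N: "?P N" "\<And>N'. ?P N' \<Longrightarrow> card (M \<inter> N') \<le> card (M \<inter> N)" by blast
  have mN: "matching E N" "\<Union>N \<subseteq> W" and mM: "matching E M" "\<Union>M \<subseteq> W"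
    using N M unfolding max_in_def by auto
  have fin: "finite (\<Union>M)" "finite (\<Union>N)" using mM mN matching_finite_Union by auto
  \<comment> \<open>Since \<open>N\<close> covers \<open>u\<close> and \<open>v\<close>, which
    \<open>M\<close> misses, equal sizes give two vertices covered only by \<open>M\<close>, one of
    them other than \<open>t\<close>.\<close>
  have "card (\<Union>M) = card (\<Union>N)"
    using card_Union_matching mM mN max_in_card_eq[OF M, of N] N by simp
  then have "card (\<Union>M - \<Union>N) = card (\<Union>N - \<Union>M)"
    using card_Int_Diff[OF fin(1), of "\<Union>N"] card_Int_Diff[OF fin(2), of "\<Union>M"] by (simp add: Int_commute)
  moreover have "card {u, v} \<le> card (\<Union>N - \<Union>M)"
    using fin uv cover[of N] N(1) by (intro card_mono) auto
  ultimately have "2 \<le> card (\<Union>M - \<Union>N)" using uv by simp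
  then have "\<not> \<Union>M - \<Union>N \<subseteq> {t}" using card_mono[of "{t}" "\<Union>M - \<Union>N"] by auto
  then obtain w where w: "w \<in> \<Union>M" "w \<notin> \<Union>N" "w \<noteq> t" by blast
  then obtain e where e: "e \<in> M" "w \<in> e" by blast
  have eE: "e \<in> E" using matching_edge[OF mM(1) e(1)] .
  obtain r s where rs: "e = {r, s}" "r \<noteq> s" using card_edge[OF eE] by (auto simp: card_2_iff)
  obtain x where x: "e = {w, x}" "x \<noteq> w"
  proof (cases "w = r")
    case True
    then show thesis using that[of s] rs by auto
  next
    case False
    then show thesis using that[of r] rs e(2) by auto
  qed
  have "e \<subseteq> W" using e(1) mM(2) by blast
  then have "x \<in> \<Union>N" using max_in_no_edge[of W N e] N(1) eE x(1) w(2) by simp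
  then obtain f where f: "f \<in> N" "x \<in> f" by blast
  \<comment> \<open>Exchanging \<open>f\<close> for \<open>e\<close> keeps the size and still misses
    \<open>t\<close>, but shares one more edge with \<open>M\<close>, because \<open>f\<close> meets
    \<open>e\<close> in \<open>x\<close> and so is not in \<open>M\<close>.\<close>
  let ?N = "insert e (N - {f})"
  note rem = matching_remove[OF mN(1) f(1)]
  have disj: "e \<inter> \<Union>(N - {f}) = {}" using rem(2) f x w by auto
  have mN': "matching E ?N" "card ?N = card N"
    using matching_insert[OF rem(1) eE disj] rem(3) by auto
  moreover have "\<Union>?N \<subseteq> W" using rem(2) mN mM e by auto
  moreover have "t \<notin> \<Union>?N" using rem(2) N(1) w x \<open>x \<in> \<Union>N\<close> by auto
  ultimately have "?P ?N" using N(1) max_inI[of W N ?N] by auto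
  moreover have "M \<inter> ?N = insert e (M \<inter> N)" "e \<notin> M \<inter> N"
  proof -
    have "f \<notin> M" using matching_disjoint[OF mM(1) e(1), of f x] x f w by auto
    then show "M \<inter> ?N = insert e (M \<inter> N)" using e by auto
    show "e \<notin> M \<inter> N" using w e by auto
  qed
  then have "card (M \<inter> ?N) = Suc (card (M \<inter> N))" using finM by simp
  ultimately show False using N(2) by fastforce
qed

text \<open>If \<open>N\<close> misses \<open>a\<close> and \<open>z\<close>, an exchange yields a
  maximum matching missing the predecessor \<open>y\<close> of \<open>z\<close> together with
  \<open>a\<close> or \<open>z\<close>. It cannot miss both ends of an edge, so it misses
  \<open>a\<close>, and \<open>a = y\<close> by induction; then \<open>N\<close> misses both ends of
  \<open>{y, z}\<close>.\<close>

lemma missed_in_component_unique: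
  assumes D: "D = missable E W"
    and "(a, b) \<in> (edge_rel {e \<in> E. e \<subseteq> D})\<^sup>*" "max_in E W N" "a \<notin> \<Union>N" "b \<notin> \<Union>N"
  shows "a = b"
  using assms(2,3,5,4)
proof (induction arbitrary: N)
  case (step y z)
  then have yz: "{y, z} \<in> E" "{y, z} \<subseteq> D" by (auto simp: edge_rel_def)
  then have W: "{y, z} \<subseteq> W" "y \<in> missable E W" unfolding D missable_def by auto
  show ?case
  proof (rule ccontr)
    assume az: "a \<noteq> z"
    obtain K where K: "max_in E W K" "y \<notin> \<Union>K" "a \<notin> \<Union>K \<or> z \<notin> \<Union>K"
      using missable_exchange[OF step.prems(1,3,2) az W(2)] by metis
    have "z \<in> \<Union>K" using max_in_no_edge[OF K(1) yz(1) W(1)] K(2) by simp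
    then have "a = y" using step.IH[OF K(1,2)] K(3) by simp
    then show False using max_in_no_edge[OF step.prems(1) yz(1) W(1)] step.prems(2,3) by simp
  qed
qed simp

text \<open>Deleting \<open>A\<close> keeps \<open>D\<close> and shrinks maximum matchings by
  \<open>card A\<close> edges, so \<open>N\<close> misses \<open>card A\<close> more vertices of
  \<open>U - A\<close> than \<open>M\<close> misses in \<open>U\<close>. They all lie in
  \<open>D\<close>, in distinct components.\<close>

lemma missable_components:
  assumes U: "finite U" and M: "max_in E U M"
  defines "D \<equiv> missable E U"
  defines "A \<equiv> {a \<in> U - D. \<exists>d\<in>D. {a, d} \<in> E}"
  shows "card A + card (U - \<Union>M) \<le> ncomp D {e \<in> E. e \<subseteq> D}"
proof -
  have A: "finite A" "A \<subseteq> U" using U unfolding A_def by auto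
  obtain N where N: "max_in E (U - A) N" by (rule max_in_exists)
  have "missable E (U - A) = missable E U \<and> (\<forall>N. max_in E (U - A) N \<longrightarrow> card M = card N + card A)"
    by (rule missable_remove_set[OF A _ M]) (auto simp: A_def D_def)
  then have D: "D = missable E (U - A)" and card: "card M = card N + card A" using N D_def by auto
  let ?S = "U - A - \<Union>N"
  have mM: "matching E M" "\<Union>M \<subseteq> U" and mN: "matching E N" "\<Union>N \<subseteq> U - A"
    using M N unfolding max_in_def by auto
  have "card ?S = card U - card A - 2 * card N" "card (U - \<Union>M) = card U - 2 * card M"
    using U A mM mN matching_finite_Union card_Union_matching by (simp_all add: card_Diff_subset)
  moreover have "2 * card M \<le> card U" using card_mono[OF U mM(2)] card_Union_matching[OF mM(1)] by simp
  ultimately have "card ?S = card A + card (U - \<Union>M)" using card by linarith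
  moreover have "card ?S \<le> ncomp D {e \<in> E. e \<subseteq> D}"
    unfolding ncomp_def
  proof (rule card_inj_on_le)
    show "inj_on (comp_of {e \<in> E. e \<subseteq> D}) ?S"
      using missed_in_component_unique[OF D _ N] by (intro inj_onI) (auto simp: comp_of_eq_iff)
    have "?S \<subseteq> D" unfolding D missable_def using N by blast
    then show "comp_of {e \<in> E. e \<subseteq> D} ` ?S \<subseteq> comp_of {e \<in> E. e \<subseteq> D} ` D" by blast
    show "finite (comp_of {e \<in> E. e \<subseteq> D} ` D)" using U unfolding D_def missable_def by simp
  qed
  ultimately show ?thesis by simp
qed

end

section \<open>Degrees of unmatched vertices\<close>

lemma finite_simple_graph_simple_edges: "finite_simple_graph V E \<Longrightarrow> simple_edges E"
  using finite_simple_graph_finite_edges unfolding finite_simple_graph_def simple_edges_def by metis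

lemma planar_subgraph_edge_bound:
  assumes "finite_simple_graph V E" "planar V E" "V' \<subseteq> V" "E' \<subseteq> E" "\<forall>e\<in>E'. e \<subseteq> V'"
  shows "card E' + 3 * ncomp V' E' \<le> 3 * card V'"
proof -
  obtain p c where pc: "plane_drawing V E p c" using assms(2) unfolding planar_def by auto
  have "finite_simple_graph V' E'"
    using assms(1,3-5) finite_subset[of V' V] unfolding finite_simple_graph_def by auto
  then have "plane_graph V' E' p c"
    using plane_drawing_subset[OF pc assms(3-5)] by unfold_locales
  then show ?thesis by (rule plane_graph_edge_bound)
qed

text \<open>Double counting: an edge contributes its number of ends in \<open>D\<close>.\<close>

lemma sum_vertex_degree:
  assumes "finite_simple_graph V E" "D \<subseteq> V"
  shows "(\<Sum>v\<in>D. vertex_degree E v) =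
    2 * card {e \<in> E. e \<subseteq> D} + card {e \<in> E. \<not> e \<subseteq> D \<and> e \<inter> D \<noteq> {}}"
proof -
  interpret simple_edges E using assms(1) by (rule finite_simple_graph_simple_edges)
  have D: "finite D" using assms finite_subset unfolding finite_simple_graph_def by metis
  let ?I = "{e \<in> E. e \<subseteq> D}" and ?B = "{e \<in> E. \<not> e \<subseteq> D \<and> e \<inter> D \<noteq> {}}"
  have card: "card (e \<inter> D) = (if e \<subseteq> D then 2 else if e \<inter> D \<noteq> {} then 1 else 0)" if e: "e \<in> E" for e
  proof -
    obtain u v where "e = {u, v}" "u \<noteq> v" using card_edge[OF e] by (auto simp: card_2_iff)
    then show ?thesis by (auto simp: Int_insert_left)
  qed
  have "(\<Sum>v\<in>D. vertex_degree E v) = (\<Sum>e\<in>E. card {v \<in> D. v \<in> e})"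
    unfolding vertex_degree_def by (rule sum_multicount_gen) (use D fin_E in auto)
  also have "\<dots> = (\<Sum>e\<in>E. (if e \<subseteq> D then 2 else 0) + (if \<not> e \<subseteq> D \<and> e \<inter> D \<noteq> {} then 1 else 0))"
  proof (rule sum.cong)
    fix e assume "e \<in> E"
    moreover have "{v \<in> D. v \<in> e} = e \<inter> D" by auto
    ultimately show "card {v \<in> D. v \<in> e} =
        (if e \<subseteq> D then 2 else 0) + (if \<not> e \<subseteq> D \<and> e \<inter> D \<noteq> {} then 1 else 0)"
      using card by simp
  qed simp
  also have "\<dots> = 2 * card ?I + card ?B"
    using fin_E by (simp add: sum.distrib sum.If_cases Int_def)
  finally show ?thesis .
qed

theorem corollary4p2:
  fixes V :: "'a set" and E :: "'a set set"
  assumes "finite_simple_graph V E"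
    and "planar V E"
  shows "\<exists>M. maximum_matching E M \<and>
           (perfect V M \<or> (\<forall>v \<in> unmatched V M. vertex_degree E v \<le> 5))"
proof -
  interpret simple_edges E using assms(1) by (rule finite_simple_graph_simple_edges)
  have V: "finite V" and edges: "\<And>e. e \<in> E \<Longrightarrow> e \<subseteq> V"
    using assms(1) unfolding finite_simple_graph_def by auto
  have maximum_iff: "maximum_matching E M \<longleftrightarrow> max_in E V M" for M
    using edges unfolding maximum_matching_def max_in_def matching_def by (meson Union_least subsetD)
  have unmatched: "unmatched V M = V - \<Union>M" for M
    unfolding unmatched_def by auto
  define bad where "bad S = {v \<in> S. 6 \<le> vertex_degree E v}" for S
  obtain M0 where "max_in E V M0" by (rule max_in_exists)
  then obtain M where M: "max_in E V M"
    and M_min: "\<And>N. max_in E V N \<Longrightarrow> card (bad (V - \<Union>M)) \<le> card (bad (V - \<Union>N))"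
    using ex_has_least_nat[of "max_in E V" M0 "\<lambda>M. card (bad (V - \<Union>M))"] by metis
  have mM: "matching E M" "\<Union>M \<subseteq> V" using M by (simp_all add: max_in_def)
  have "vertex_degree E u \<le> 5" if u: "u \<in> V - \<Union>M" for u
  proof (rule ccontr)
    assume "\<not> vertex_degree E u \<le> 5"
    then have deg_u: "6 \<le> vertex_degree E u" by simp
    \<comment> \<open>Once \<open>W\<close> is deleted, \<open>u\<close> is the only vertex that
      \<open>M\<close> misses.\<close>
    define W where "W = V - \<Union>M - {u}"
    define U where "U = V - W"
    have W: "finite W" "W \<subseteq> V" "u \<notin> W" "V - \<Union>M = insert u W" using V u unfolding W_def by auto
    have U: "finite U" "U \<subseteq> V" "U \<inter> W = {}" "V = U \<union> W" using V W unfolding U_def by auto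
    have UM: "\<Union>M \<subseteq> U" "u \<in> U" using mM u unfolding U_def W_def by auto
    have MU: "max_in E U M"
      using max_in_card_le[OF M] mM UM U(2) unfolding max_in_def by blast
    define D where "D = missable E U"
    define A where "A = {a \<in> U - D. \<exists>d\<in>D. {a, d} \<in> E}"
    have DU: "D \<subseteq> U" unfolding D_def missable_def by auto
    have uD: "u \<in> D" unfolding D_def missable_iff using MU UM u by blast
    \<comment> \<open>A maximum matching \<open>N\<close> of \<open>U\<close> missing
      \<open>w\<close> is also maximum in \<open>V\<close> and leaves exactly
      \<open>insert w W\<close> unmatched. A smaller degree of \<open>w\<close> would contradict the
      choice of \<open>M\<close>, and an edge from \<open>w\<close> into \<open>W\<close> could be
      added to \<open>N\<close>.\<close>
    have reach: "6 \<le> vertex_degree E w \<and> (\<forall>e\<in>E. w \<in> e \<longrightarrow> e \<inter> W = {})" if wD: "w \<in> D" for w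
    proof -
      obtain N where N: "max_in E U N" "w \<notin> \<Union>N" using wD unfolding D_def missable_iff by blast
      have w: "w \<in> U" using wD DU by blast
      have mN: "matching E N" "\<Union>N \<subseteq> U" using N by (simp_all add: max_in_def)
      have cardMN: "card N = card M" by (rule max_in_card_eq[OF N(1) MU])
      have N_max: "max_in E V N"
        using max_inI[OF M mN(1)] mN(2) U(2) cardMN by simp
      have "insert w W \<subseteq> V - \<Union>N" using w N(2) mN(2) U W(2) by auto
      moreover have "card (insert w W) = card (V - \<Union>N)"
      proof -
        have "card (insert w W) = card (insert u W)" using w U(3) W by (metis IntI card_insert_disjoint empty_iff)
        also have "\<dots> = card (V - \<Union>M)" using W by simp
        also have "\<dots> = card (V - \<Union>N)"
          using cardMN V mM mN U(2) matching_finite_Union card_Union_matching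
          by (simp add: card_Diff_subset)
        finally show ?thesis .
      qed
      ultimately have VN: "insert w W = V - \<Union>N" using V by (intro card_subset_eq) auto
      have fin_bad: "finite (bad W)" using W(1) unfolding bad_def by simp
      have "6 \<le> vertex_degree E w"
      proof (rule ccontr)
        assume "\<not> 6 \<le> vertex_degree E w"
        then have "bad (V - \<Union>N) = bad W" unfolding VN[symmetric] bad_def by auto
        moreover have "bad (V - \<Union>M) = insert u (bad W)" unfolding W(4) bad_def using deg_u by auto
        moreover have "u \<notin> bad W" using W(3) unfolding bad_def by simp
        ultimately show False using M_min[OF N_max] fin_bad by simp
      qed
      moreover have "e \<inter> W = {}" if e: "e \<in> E" "w \<in> e" for e
      proof (rule ccontr)
        assume "e \<inter> W \<noteq> {}"
        then obtain z where z: "z \<in> e" "z \<in> W" by blast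
        have "z \<noteq> w" using z(2) w U(3) by blast
        then have "e = {w, z}" using card_edge[OF e(1)] e(2) z(1) by (auto simp: card_2_iff)
        then have "e \<inter> \<Union>N = {}" using z(2) VN by blast
        then show False using max_in_no_edge[OF N_max e(1) edges[OF e(1)]] by simp
      qed
      ultimately show ?thesis by blast
    qed
    let ?I = "{e \<in> E. e \<subseteq> D}" and ?B = "{e \<in> E. \<not> e \<subseteq> D \<and> e \<inter> D \<noteq> {}}"
    have A: "finite A" "finite D" "A \<inter> D = {}" "A \<subseteq> V" "D \<subseteq> V"
      using U DU finite_subset unfolding A_def by auto
    \<comment> \<open>No edge leads from \<open>D\<close> to \<open>W\<close>, so every neighbour of
      \<open>D\<close> lies in \<open>U\<close>, hence in \<open>D\<close> or in
      \<open>A\<close>.\<close>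
    have sub: "e \<subseteq> A \<union> D" if e: "e \<in> E" "e \<inter> D \<noteq> {}" for e
    proof
      fix z assume z: "z \<in> e"
      obtain w where w: "w \<in> e" "w \<in> D" using e by blast
      have "z \<in> U" using reach[OF w(2)] e(1) w(1) z edges[OF e(1)] U(4) by blast
      moreover have "z = w \<or> e = {z, w}" using card_edge[OF e(1)] w(1) z by (auto simp: card_2_iff)
      ultimately show "z \<in> A \<union> D" using w e(1) unfolding A_def by blast
    qed
    have deg: "6 * card D \<le> 2 * card ?I + card ?B"
    proof -
      have "6 * card D = (\<Sum>v\<in>D. 6)" by simp
      also have "\<dots> \<le> (\<Sum>v\<in>D. vertex_degree E v)" using reach by (intro sum_mono) blast
      finally show ?thesis using sum_vertex_degree[OF assms(1) A(5)] by simp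
    qed
    have "card ?I + 3 * ncomp D ?I \<le> 3 * card D"
      by (rule planar_subgraph_edge_bound[OF assms A(5)]) auto
    moreover have "card (?I \<union> ?B) + 3 * ncomp (A \<union> D) (?I \<union> ?B) \<le> 3 * card (A \<union> D)"
    proof (rule planar_subgraph_edge_bound[OF assms])
      show "A \<union> D \<subseteq> V" using A by blast
      show "\<forall>e\<in>?I \<union> ?B. e \<subseteq> A \<union> D" using sub by blast
    qed auto
    moreover have "card (?I \<union> ?B) = card ?I + card ?B" using fin_E by (intro card_Un_disjoint) auto
    moreover have "card (A \<union> D) = card A + card D" using A by (intro card_Un_disjoint) auto
    \<comment> \<open>This one component makes the final inequality strict; it exists because
      \<open>u\<close> lies in \<open>D\<close>.\<close>
    moreover have "0 < ncomp (A \<union> D) (?I \<union> ?B)" using A uD by (intro ncomp_pos) auto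
    moreover have "card A \<le> ncomp D ?I"
      using missable_components[OF U(1) MU] unfolding D_def[symmetric] A_def[symmetric] by simp
    ultimately show False using deg by linarith
  qed
  then show ?thesis using M maximum_iff unmatched by metis
qed

end
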